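(* Let $a, b$ be nonzero integers with $|a| \neq 1$. Then there exist constants $c>0$ and $x_0$, depending on $a$ and $b$, such that for all $x \geq x_0$, $$\#\{p \leq x \text{ prime} : p \nmid ab \text{ and } b \bmod p \in \langle a \bmod p \rangle \subset \mathbb{F}_p^*\} \geq c \log\log x .$$
   Context: Here $\langle a \bmod p\rangle$ denotes the cyclic subgroup of the multiplicative group $\mathbb{F}_p^*$ generated by the residue of $a$ modulo $p$; the condition $b \bmod p \in \langle a \bmod p\rangle$ means $b \equiv a^n \pmod p$ for some integer $n \geq 0$. *)

theory Defs
  imports Complex_Main "HOL-Number_Theory.Number_Theory" "HOL-Algebra.Generated_Groups"
begin

(* \<langle>a mod p\<rangle>.  residue_ring represents the elements of F_p by the integers
   0, ..., p - 1, so the class of a is a mod int p.  The set is the intended subgroup of F_p^*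
   only for p prime with p not dividing a; otherwise a mod int p need not lie in the group. *)
definition residue_subgroup :: "int \<Rightarrow> nat \<Rightarrow> int set"
  where "residue_subgroup a p = generate (mult_of (residue_ring (int p))) {a mod int p}"

lemma mem_residue_subgroup_iff:
  fixes a b :: int and p :: nat
  assumes p: "prime p" and a: "\<not> int p dvd a"
  shows "b mod int p \<in> residue_subgroup a p \<longleftrightarrow> (\<exists>n::nat. [b = a ^ n] (mod int p))"
proof -
  interpret residues_prime p "residue_ring (int p)"
    by unfold_locales (use p in auto)
  let ?G = "mult_of (residue_ring (int p))"
  have p1: "int p > 1" using p prime_gt_1_nat by auto
  interpret G: group ?G
    by (rule field_mult_group)
  have fin: "finite (carrier ?G)"
    by (simp add: residue_ring_def)
  have car: "a mod int p \<in> carrier ?G"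
    using a p1 by (simp add: residue_ring_def dvd_eq_mod_eq_0)
  have pow: "(a mod int p) [^]\<^bsub>?G\<^esub> n = a ^ n mod int p" for n :: nat
    using p1 by (induction n)
      (simp_all add: nat_pow_def residue_ring_def mod_simps mult.commute)
  show ?thesis
    unfolding residue_subgroup_def G.generate_pow_on_finite_carrier[OF fin car]
    by (auto simp: pow cong_def)
qed

end

theory Submission
  imports Defs "HOL-Real_Asymp.Real_Asymp"
begin

text \<open>
  Let \<open>k\<close> be the number of admissible primes up to \<open>x\<close>. If \<open>|a|^(2 N) \<le> x / 2\<close> and
  \<open>N \<le> n \<le> N + k \<le> 2 N\<close>, the primes dividing \<open>a^n - b\<close> but not \<open>a b\<close> are admissible, and the
  remaining primes contribute at most a divisor of \<open>b\<close>. Hence some admissible prime power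
  dividing \<open>a^n - b\<close> is at least \<open>(|a^n - b| / |b|)^(1/k)\<close>. Among these \<open>k + 1\<close> exponents two,
  say \<open>n < m\<close>, share their prime, and the smaller of the two prime powers divides
  \<open>a^(m - n) - 1\<close>, where \<open>m - n \<le> k\<close>. Comparing sizes yields \<open>N \<le> k (k + 1) + 2 |b|\<close>, so \<open>k\<close>
  even grows at least like a multiple of \<open>sqrt (ln x)\<close>.
\<close>

text \<open>Subtracting eliminates \<open>b\<close>: the difference is \<open>a ^ n\<close> times
  \<open>a ^ (m - n) - 1\<close>, and \<open>q\<close> is coprime to the first factor. Only the gap
  between the exponents remains.\<close>

lemma dvd_power_diff_gap:
  fixes a b q :: int
  assumes "coprime q a" "n \<le> m" "q dvd a ^ n - b" "q dvd a ^ m - b"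
  shows "q dvd a ^ (m - n) - 1"
proof -
  have "q dvd (a ^ m - b) - (a ^ n - b)"
    using assms(3,4) by (rule dvd_diff[rotated])
  also have "(a ^ m - b) - (a ^ n - b) = a ^ n * (a ^ (m - n) - 1)"
    using assms(2) by (simp add: algebra_simps flip: power_add)
  finally show ?thesis
    using assms(1) by (simp add: coprime_dvd_mult_right_iff)
qed

lemma abs_power_diff_one_le:
  fixes a :: int
  assumes "\<bar>a\<bar> \<ge> 2"
  shows "\<bar>a ^ d - 1\<bar> \<le> \<bar>a\<bar> ^ Suc d"
proof -
  have "\<bar>a ^ d - 1\<bar> \<le> \<bar>a\<bar> ^ d + 1"
    by (metis abs_1 abs_triangle_ineq4 power_abs)
  also have "\<dots> \<le> 2 * \<bar>a\<bar> ^ d"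
    using one_le_power[of "\<bar>a\<bar>" d] assms by linarith
  also have "\<dots> \<le> \<bar>a\<bar> ^ Suc d"
    using assms by (simp add: mult_right_mono)
  finally show ?thesis .
qed

text \<open>A higher power of \<open>p\<close> dividing \<open>a ^ n - b\<close> is impossible: if
  \<open>p\<close> divides \<open>a\<close>, it would divide \<open>a ^ n\<close> and hence
  \<open>b\<close>; if not, \<open>p\<close> divides \<open>b\<close> but not \<open>a ^ n\<close>.
  The bound on \<open>n\<close> is a crude way to make \<open>n\<close> exceed the multiplicity of
  \<open>p\<close> in \<open>b\<close>.\<close>

lemma multiplicity_power_diff_le:
  fixes a b p :: int
  assumes p: "prime p" "p dvd a * b" and b: "b \<noteq> 0" and n: "\<bar>b\<bar> \<le> int n"
  shows "multiplicity p (a ^ n - b) \<le> multiplicity p b"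
proof (rule ccontr)
  let ?f = "multiplicity p b"
  assume "\<not> ?thesis"
  then have dvd: "p ^ Suc ?f dvd a ^ n - b"
    by (intro multiplicity_dvd') auto
  have "p \<ge> 2" using p(1) by (rule prime_ge_2_int)
  have "int ?f < 2 ^ ?f" by (rule of_nat_less_two_power)
  also have "\<dots> \<le> p ^ ?f" using \<open>p \<ge> 2\<close> by (intro power_mono) auto
  also have "\<dots> \<le> \<bar>b\<bar>" using b by (intro zdvd_imp_le) (auto simp: multiplicity_dvd)
  finally have fn: "Suc ?f \<le> n" using n by linarith
  show False
  proof (cases "p dvd a")
    case True
    then have "p ^ Suc ?f dvd a ^ n"
      using fn by (meson dvd_power_same dvd_trans le_imp_power_dvd)
    with dvd have "p ^ Suc ?f dvd b"
      by (metis dvd_diff_right_iff)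
    then have "Suc ?f \<le> ?f"
      using b p(1) by (intro multiplicity_geI) auto
    then show False by simp
  next
    case False
    then have "p dvd b" using p by (simp add: prime_dvd_mult_iff)
    moreover have "p dvd a ^ n - b" using dvd by (meson dvd_trans dvd_power zero_less_Suc)
    ultimately have "p dvd a ^ n" by (metis dvd_diff_left_iff)
    with False p(1) show False by (meson prime_dvd_power)
  qed
qed

text \<open>Multiplicities are compared prime by prime: the factor \<open>b\<close> absorbs the
  primes dividing \<open>a * b\<close>, and every other prime divisor of \<open>a ^ n - b\<close>
  lies in \<open>S\<close>.\<close>

lemma power_diff_dvd_mult_prod:
  fixes a b :: int
  assumes b: "b \<noteq> 0" and n: "\<bar>b\<bar> \<le> int n" and nz: "a ^ n - b \<noteq> 0"
    and S: "finite S" "\<And>p. p \<in> S \<Longrightarrow> prime p"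
    and inS: "\<And>p. prime p \<Longrightarrow> \<not> p dvd a * b \<Longrightarrow> p dvd a ^ n - b \<Longrightarrow> p \<in> S"
  shows "a ^ n - b dvd b * (\<Prod>p\<in>S. p ^ multiplicity p (a ^ n - b))"
proof (rule multiplicity_le_imp_dvd)
  let ?P = "\<Prod>p\<in>S. p ^ multiplicity p (a ^ n - b)"
  have P: "?P \<noteq> 0" using S by auto
  fix p :: int assume p: "prime p"
  have split: "multiplicity p (b * ?P) = multiplicity p b + multiplicity p ?P"
    using b P p by (intro prime_elem_multiplicity_mult_distrib) auto
  consider "p dvd a * b" | "\<not> p dvd a ^ n - b" | "p \<in> S" using inS p by blast
  then show "multiplicity p (a ^ n - b) \<le> multiplicity p (b * ?P)"
  proof cases
    case 1
    with multiplicity_power_diff_le[OF p 1 b n] split show ?thesis by linarith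
  next
    case 2
    then show ?thesis by (simp add: not_dvd_imp_multiplicity_0)
  next
    case 3
    then have "p ^ multiplicity p (a ^ n - b) dvd ?P"
      using S(1) by (rule dvd_prodI[rotated])
    then have "multiplicity p (a ^ n - b) \<le> multiplicity p ?P"
      using P p by (intro multiplicity_geI) auto
    with split show ?thesis by linarith
  qed
qed (use nz in auto)

text \<open>The product over \<open>S\<close> is at most its largest factor raised to the power
  \<open>card S\<close>.\<close>

lemma large_prime_power_divisor:
  fixes a b :: int
  assumes b: "b \<noteq> 0" and n: "\<bar>b\<bar> \<le> int n" and large: "\<bar>a ^ n - b\<bar> > \<bar>b\<bar>"
    and S: "finite S" "\<And>p. p \<in> S \<Longrightarrow> prime p"
    and inS: "\<And>p. prime p \<Longrightarrow> \<not> p dvd a * b \<Longrightarrow> p dvd a ^ n - b \<Longrightarrow> p \<in> S"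
  shows "\<exists>p\<in>S. \<bar>a ^ n - b\<bar> \<le> \<bar>b\<bar> * (p ^ multiplicity p (a ^ n - b)) ^ card S"
proof -
  define f where "f p = p ^ multiplicity p (a ^ n - b)" for p
  have f1: "f p \<ge> 1" if "p \<in> S" for p
    using S(2)[OF that] by (auto simp: f_def dest: prime_gt_0_int)
  have "prod f S \<noteq> 0" using S by (auto simp: f_def)
  moreover have "a ^ n - b dvd b * prod f S"
    unfolding f_def using large by (intro power_diff_dvd_mult_prod[OF b n _ S inS]) auto
  ultimately have le: "\<bar>a ^ n - b\<bar> \<le> \<bar>b\<bar> * \<bar>prod f S\<bar>"
    using b dvd_imp_le_int[of "b * prod f S"] by (simp add: abs_mult)
  \<comment> \<open>An empty product would give
    \<open>\<bar>a ^ n - b\<bar> \<le> \<bar>b\<bar>\<close>.\<close>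
  have "S \<noteq> {}" using le large by auto
  then have "Max (f ` S) \<in> f ` S" using S(1) by (intro Max_in) auto
  then obtain p where p: "p \<in> S" "f p = Max (f ` S)" by auto
  have "prod f S \<le> f p ^ card S"
    using S(1) f1 p(1) by (intro prod_le_power) (force simp: p(2))+
  moreover have "prod f S \<ge> 0"
    using f1 by (intro prod_nonneg) force
  ultimately have "\<bar>a ^ n - b\<bar> \<le> \<bar>b\<bar> * f p ^ card S"
    using le by (smt (verit) mult_left_mono)
  with p(1) show ?thesis by (auto simp: f_def)
qed

text \<open>The pigeonhole argument, for an abstract set \<open>S\<close>. Membership in
  \<open>S\<close> is demanded only for exponents in a short window, which later keeps the primes
  below \<open>x\<close>.\<close>

lemma exponent_le_card_prime_divisors:
  fixes a b :: int
  assumes a: "\<bar>a\<bar> \<ge> 2" and b: "b \<noteq> 0" and N: "\<bar>b\<bar> \<le> int N"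
    and S: "finite S" "\<And>p. p \<in> S \<Longrightarrow> prime p \<and> \<not> p dvd a"
    and inS: "\<And>n p. N \<le> n \<Longrightarrow> n \<le> N + card S \<Longrightarrow> prime p \<Longrightarrow> \<not> p dvd a * b \<Longrightarrow>
                p dvd a ^ n - b \<Longrightarrow> p \<in> S"
  shows "N \<le> card S * (card S + 1) + 2 * nat \<bar>b\<bar>"
proof (rule ccontr)
  define k where "k = card S"
  define v where "v p n = multiplicity p (a ^ n - b)" for p n
  let ?B = "nat \<bar>b\<bar>"
  let ?M = "\<bar>a\<bar> ^ (k * (k + 1))"
  assume "\<not> ?thesis"
  then have Nk: "k * (k + 1) + 2 * ?B \<le> N" by (simp add: k_def)
  have M: "?M \<ge> 1" using a by (intro one_le_power) auto
  \<comment> \<open>The summand \<open>2 * ?B\<close> in the bound pays for the factor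
    \<open>2 * \<bar>b\<bar>\<close>; the other summand yields \<open>?M\<close>, the eventual upper
    bound for \<open>(p ^ e) ^ k\<close>.\<close>
  have "int (2 * ?B) < 2 ^ (2 * ?B)" by (rule of_nat_less_two_power)
  also have "\<dots> \<le> \<bar>a\<bar> ^ (2 * ?B)" using a by (intro power_mono) auto
  finally have "2 * \<bar>b\<bar> < \<bar>a\<bar> ^ (2 * ?B)" by simp
  then have "2 * \<bar>b\<bar> * ?M < \<bar>a\<bar> ^ (2 * ?B) * ?M"
    using M by (intro mult_strict_right_mono) linarith+
  also have "\<dots> = \<bar>a\<bar> ^ (k * (k + 1) + 2 * ?B)" by (simp add: power_add)
  also have "\<dots> \<le> \<bar>a\<bar> ^ N" using Nk a by (intro power_increasing) auto
  finally have aN: "2 * \<bar>b\<bar> * ?M < \<bar>a\<bar> ^ N" .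
  have z: "\<bar>b\<bar> * ?M < \<bar>a ^ n - b\<bar>" if "N \<le> n" for n
  proof -
    have "\<bar>a\<bar> ^ N \<le> \<bar>a\<bar> ^ n" using that a by (intro power_increasing) auto
    moreover have "\<bar>a\<bar> ^ n - \<bar>b\<bar> \<le> \<bar>a ^ n - b\<bar>" by (metis abs_triangle_ineq2 power_abs)
    moreover have "\<bar>b\<bar> \<le> \<bar>b\<bar> * ?M" using M by (simp add: mult_le_cancel_left1)
    ultimately show ?thesis using aN by linarith
  qed
  have bM: "\<bar>b\<bar> \<le> \<bar>b\<bar> * ?M" using M by (simp add: mult_le_cancel_left1)
  have "\<exists>p\<in>S. \<bar>a ^ n - b\<bar> \<le> \<bar>b\<bar> * (p ^ v p n) ^ k" if "n \<in> {N..N + k}" for n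
    unfolding k_def v_def
  proof (rule large_prime_power_divisor)
    show "\<bar>b\<bar> < \<bar>a ^ n - b\<bar>" using z[of n] bM that by auto
    show "\<bar>b\<bar> \<le> int n" using N that by auto
  qed (use S b inS that in \<open>auto simp: k_def\<close>)
  then obtain P where P: "\<And>n. n \<in> {N..N + k} \<Longrightarrow> P n \<in> S"
      "\<And>n. n \<in> {N..N + k} \<Longrightarrow> \<bar>a ^ n - b\<bar> \<le> \<bar>b\<bar> * (P n ^ v (P n) n) ^ k"
    by metis
  \<comment> \<open>There are \<open>k + 1\<close> exponents but only \<open>k\<close>
    primes.\<close>
  have "\<not> inj_on P {N..N + k}"
  proof
    assume "inj_on P {N..N + k}"
    then have "card {N..N + k} \<le> card S" using P(1) S(1) by (intro card_inj_on_le) auto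
    then show False by (simp add: k_def)
  qed
  then obtain n m where nm: "n \<in> {N..N + k}" "m \<in> {N..N + k}" "n < m" "P n = P m"
    unfolding inj_on_def by (metis linorder_neqE_nat)
  define p where "p = P n"
  \<comment> \<open>With the minimum, \<open>p ^ e\<close> divides both differences and still
    inherits the lower bound from one of them.\<close>
  define e where "e = min (v p n) (v p m)"
  have p: "prime p" "\<not> p dvd a" using S(2) P(1) nm(1) by (auto simp: p_def)
  have e: "\<exists>l\<ge>N. \<bar>a ^ l - b\<bar> \<le> \<bar>b\<bar> * (p ^ e) ^ k"
  proof (cases "v p n \<le> v p m")
    case True
    then show ?thesis using P(2)[OF nm(1)] nm(1) by (auto simp: e_def p_def)
  next
    case False
    then show ?thesis using P(2)[OF nm(2)] nm(2,4) by (auto simp: e_def p_def)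
  qed
  \<comment> \<open>A divisor is bounded by a multiple only if that multiple is nonzero.\<close>
  have "a ^ (m - n) \<noteq> 1"
  proof
    assume "a ^ (m - n) = 1"
    then have "\<bar>a\<bar> ^ (m - n) = 1" by (metis abs_1 power_abs)
    with one_less_power[of "\<bar>a\<bar>" "m - n"] a nm(3) show False by simp
  qed
  moreover have "p ^ e dvd a ^ (m - n) - 1"
  proof (rule dvd_power_diff_gap)
    show "coprime (p ^ e) a" using p by (simp add: prime_imp_coprime)
    show "p ^ e dvd a ^ n - b" "p ^ e dvd a ^ m - b"
      by (auto intro!: multiplicity_dvd' simp: e_def v_def)
  qed (use nm in auto)
  ultimately have "\<bar>p ^ e\<bar> \<le> \<bar>a ^ (m - n) - 1\<bar>" by (intro dvd_imp_le_int) auto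
  also have "\<dots> \<le> \<bar>a\<bar> ^ Suc (m - n)" using a by (rule abs_power_diff_one_le)
  also have "\<dots> \<le> \<bar>a\<bar> ^ (k + 1)" using nm a by (intro power_increasing) auto
  finally have "\<bar>p ^ e\<bar> ^ k \<le> (\<bar>a\<bar> ^ (k + 1)) ^ k" by (intro power_mono) auto
  also have "\<dots> = ?M" by (simp only: power_mult[symmetric] mult.commute)
  finally have "(p ^ e) ^ k \<le> ?M" by (metis abs_le_D1 power_abs)
  then have "\<bar>b\<bar> * (p ^ e) ^ k \<le> \<bar>b\<bar> * ?M" by (intro mult_left_mono) auto
  with e z show False by fastforce
qed

text \<open>A prime dividing \<open>a ^ n - b\<close> but not \<open>a * b\<close> puts
  \<open>b\<close> into the subgroup generated by \<open>a\<close>, and its size is at most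
  \<open>2 * \<bar>a\<bar> ^ n\<close>.\<close>

lemma exponent_le_card_residue_primes:
  fixes a b :: int and x :: real
  assumes a: "\<bar>a\<bar> \<ge> 2" and b: "b \<noteq> 0" and N: "\<bar>b\<bar> \<le> int N"
    and x: "2 * real_of_int \<bar>a\<bar> ^ (2 * N) \<le> x"
  defines "k \<equiv> card {p::nat. prime p \<and> real p \<le> x \<and> \<not> int p dvd a * b \<and>
                            b mod int p \<in> residue_subgroup a p}"
  shows "N \<le> k * (k + 1) + 2 * nat \<bar>b\<bar>"
\<comment> \<open>In this case \<open>n \<le> N + k \<le> 2 * N\<close>, which gives
  \<open>p \<le> x\<close>; otherwise \<open>N < k\<close> and the bound is immediate.\<close>
proof (cases "k \<le> N")
  case True
  define T where "T = {p::nat. prime p \<and> real p \<le> x \<and> \<not> int p dvd a * b \<and>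
                               b mod int p \<in> residue_subgroup a p}"
  have "finite T"
    by (rule finite_subset[of _ "{..nat \<lfloor>x\<rfloor>}"]) (auto simp: T_def le_nat_floor)
  have k: "card (int ` T) = k" by (simp add: card_image k_def T_def)
  have "N \<le> card (int ` T) * (card (int ` T) + 1) + 2 * nat \<bar>b\<bar>"
  proof (rule exponent_le_card_prime_divisors[OF a b N])
    show "finite (int ` T)" using \<open>finite T\<close> by simp
    show "prime p \<and> \<not> p dvd a" if "p \<in> int ` T" for p
      using that by (auto simp: T_def)
  next
    fix n p
    assume n: "N \<le> n" "n \<le> N + card (int ` T)"
      and p: "prime p" "\<not> p dvd a * b" "p dvd a ^ n - b"
    have "n < 2 ^ n" by (rule less_exp)
    then have "\<bar>b\<bar> < 2 ^ n" using N n(1)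
      by (smt (verit) of_nat_less_two_power of_nat_mono)
    also have "\<dots> \<le> \<bar>a\<bar> ^ n" using a by (intro power_mono) auto
    finally have bn: "\<bar>b\<bar> < \<bar>a\<bar> ^ n" .
    then have "a ^ n - b \<noteq> 0" by (auto simp: power_abs)
    then have "p \<le> \<bar>a ^ n - b\<bar>" using p(3) by (simp add: dvd_imp_le_int zdvd_imp_le)
    also have "\<dots> \<le> \<bar>a\<bar> ^ n + \<bar>b\<bar>" by (metis abs_triangle_ineq4 power_abs)
    also have "\<dots> \<le> 2 * \<bar>a\<bar> ^ n" using bn by simp
    also have "\<dots> \<le> 2 * \<bar>a\<bar> ^ (2 * N)"
      using n(2) True k a by (intro mult_left_mono power_increasing) auto
    finally have "real_of_int p \<le> real_of_int (2 * \<bar>a\<bar> ^ (2 * N))" by linarith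
    then have px: "real_of_int p \<le> x" using x by simp
    obtain q where q: "p = int q" using p(1) by (metis prime_ge_0_int zero_le_imp_eq_int)
    have "prime q" "\<not> int q dvd a" using p q by auto
    moreover have "[b = a ^ n] (mod int q)"
      using p(3) q by (simp add: cong_iff_dvd_diff dvd_diff_commute)
    ultimately have "b mod int q \<in> residue_subgroup a q"
      using mem_residue_subgroup_iff by blast
    then show "p \<in> int ` T" using p px q by (auto simp: T_def)
  qed
  then show ?thesis by (simp only: k)
qed (auto simp: trans_le_add1)

theorem theorem1p2:
  fixes a b :: int
  assumes "a \<noteq> 0" and "b \<noteq> 0" and "\<bar>a\<bar> \<noteq> 1"
  shows "\<exists>(c::real) (x0::real). c > 0 \<and>
    (\<forall>x::real. x \<ge> x0 \<longrightarrow>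
      real (card {p::nat. prime p \<and> real p \<le> x \<and> \<not> int p dvd a * b \<and>
                          b mod int p \<in> residue_subgroup a p})
        \<ge> c * ln (ln x))"
proof -
  have a: "\<bar>a\<bar> \<ge> 2" using assms(1,3) by linarith
  define A where "A = real_of_int \<bar>a\<bar>"
  define C where "C = ln A"
  define B where "B = real_of_int \<bar>b\<bar>"
  have "A \<ge> 2" using a by (simp add: A_def)
  then have C: "C > 0" by (simp add: C_def)
  \<comment> \<open>The left side will be a lower bound for \<open>N\<close>; the right side is the
    upper bound for \<open>N\<close> with \<open>k\<close> replaced by
    \<open>ln (ln x)\<close>.\<close>
  have "eventually (\<lambda>x. ln (x / 2) / (2 * C) - 1 > ln (ln x) * (ln (ln x) + 1) + 2 * B) at_top"
    using C by real_asymp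
  moreover have "eventually (\<lambda>x. ln (x / 2) / (2 * C) - 1 > B) at_top"
    using C by real_asymp
  moreover have "eventually (\<lambda>x::real. x > 0 \<and> ln (ln x) > 0) at_top"
    by (intro eventually_conj; real_asymp)
  ultimately have "eventually (\<lambda>x. ln (x / 2) / (2 * C) - 1 > ln (ln x) * (ln (ln x) + 1) + 2 * B \<and>
      ln (x / 2) / (2 * C) - 1 > B \<and> x > 0 \<and> ln (ln x) > 0) at_top"
    by eventually_elim auto
  then obtain x0 where x0: "\<And>x. x \<ge> x0 \<Longrightarrow>
      ln (x / 2) / (2 * C) - 1 > ln (ln x) * (ln (ln x) + 1) + 2 * B \<and>
      ln (x / 2) / (2 * C) - 1 > B \<and> x > 0 \<and> ln (ln x) > 0"
    unfolding eventually_at_top_linorder by blast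
  have "1 * ln (ln x) \<le> real (card {p::nat. prime p \<and> real p \<le> x \<and> \<not> int p dvd a * b \<and>
                          b mod int p \<in> residue_subgroup a p})"
    (is "_ \<le> real ?k") if "x \<ge> x0" for x
  proof (rule ccontr)
    let ?L = "ln (ln x)"
    let ?y = "ln (x / 2) / (2 * C)"
    \<comment> \<open>The largest \<open>N\<close> with
      \<open>2 * A ^ (2 * N) \<le> x\<close>.\<close>
    define N where "N = nat \<lfloor>?y\<rfloor>"
    note x = x0[OF that]
    have "?y \<ge> 0" using x by (auto simp: B_def)
    then have N: "real N \<le> ?y" "?y - 1 < real N" unfolding N_def by linarith+
    have "B \<le> real N" using x N by linarith
    then have bN: "\<bar>b\<bar> \<le> int N" unfolding B_def by linarith
    have "ln (A ^ (2 * N)) = 2 * C * real N"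
      using \<open>A \<ge> 2\<close> by (simp add: C_def ln_realpow)
    also have "\<dots> \<le> ln (x / 2)" using N(1) C by (simp add: field_simps)
    finally have "2 * A ^ (2 * N) \<le> x" using x \<open>A \<ge> 2\<close> by simp
    then have "N \<le> ?k * (?k + 1) + 2 * nat \<bar>b\<bar>"
      by (rule exponent_le_card_residue_primes[OF a assms(2) bN, folded A_def])
    then have "real N \<le> real (?k * (?k + 1) + 2 * nat \<bar>b\<bar>)" by (simp only: of_nat_le_iff)
    also have "\<dots> = real ?k * (real ?k + 1) + 2 * B" by (simp add: B_def algebra_simps)
    finally have "real N \<le> real ?k * (real ?k + 1) + 2 * B" .
    moreover assume "\<not> 1 * ?L \<le> real ?k"
    then have "real ?k * (real ?k + 1) \<le> ?L * (?L + 1)"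
      by (intro mult_mono) auto
    ultimately show False using N(2) x by linarith
  qed
  then show ?thesis by (intro exI[of _ 1] exI[of _ x0]) auto
qed

end
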